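(* Let $a,b>0$ be constants and let $D_4$ be a diagonal-norm fourth-derivative SBP operator with associated $H,N\in\mathbb{R}^{m\times m}$ and boundary vectors $e_l,e_r,d_{1;l},d_{1;r},d_{2;l},d_{2;r},d_{3;l},d_{3;r}\in\mathbb{R}^m$. Let $$L_c=\begin{bmatrix} e_l^\top\\ d_{1;l}^\top\\ e_r^\top\\ d_{1;r}^\top\end{bmatrix},\qquad P=I_m-H^{-1}L_c^\top(L_cH^{-1}L_c^\top)^{-1}L_c .$$ Then the semi-discrete system $$b\,v_{tt}=-a\,P D_4 P\,v$$ is a stable approximation of the dynamic beam equation $b u_{tt}=-a u_{xxxx}$, $x\in[x_l,x_r]$, with clamped boundary conditions $u=0$, $u_x=0$ at $x=x_l$ and $x=x_r$.
   Context: The interval $[x_l,x_r]$ is discretized by $m$ equidistant points with spacing $h=(x_r-x_l)/(m-1)$; $v(t)\in\mathbb{R}^m$ is the vector of grid values approximating $u(\cdot,t)$. $I_m$ is the $m\times m$ identity matrix. $e_l=(1,0,\dots,0)^\top$, $e_r=(0,\dots,0,1)^\top$. Diagonal-norm fourth-derivative SBP operator: a matrix $$D_4=H^{-1}\left(N+e_l d_{3;l}^\top+d_{1;l}d_{2;l}^\top+e_r d_{3;r}^\top-d_{1;r}d_{2;r}^\top\right)$$ approximating $\partial^4/\partial x^4$ (with a $2p$th-order accurate narrow stencil in the interior), where $H=H^\top>0$ is diagonal, $N=N^\top\ge 0$ (positive semi-definite), and $d_{1;l}^\top v\approx -u_x|_{x_l}$, $d_{1;r}^\top v\approx u_x|_{x_r}$,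 $d_{2;l}^\top v\approx -u_{xx}|_{x_l}$, $d_{2;r}^\top v\approx u_{xx}|_{x_r}$, $d_{3;l}^\top v\approx -u_{xxx}|_{x_l}$, $d_{3;r}^\top v\approx u_{xxx}|_{x_r}$ are finite difference approximations of the boundary derivatives. The clamped conditions are discretized as $L_c v=0$. The rows of $L_c$ are assumed linearly independent, so that the inverse in $P$ exists. Write $\|v\|_H^2=v^\top Hv$. Stable (in the energy sense, with zero boundary and forcing data) means: there is a time-independent symmetric positive semi-definite matrix $M\in\mathbb{R}^{m\times m}$ such that for every twice continuously differentiable solution $v(t)$ of the system, the energy $E=b\|v_t\|_H^2+v^\top M v$ satisfies $\frac{d}{dt}E\le 0$. *)

theory Defs
  imports "HOL-Analysis.Analysis" "HOL-Computational_Algebra.Polynomial"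
begin

text \<open>
  Grid points are indexed by a finite linearly ordered type \<open>'m\<close>, so that \<open>m = CARD('m)\<close> and
  \<open>grid_index\<close> is the position \<open>0, \<dots>, m - 1\<close> of an index in this order.
\<close>

definition grid_index :: "'m::{finite,linorder} \<Rightarrow> nat" where
  "grid_index i = card {j. j < i}"

definition grid_point :: "real \<Rightarrow> real \<Rightarrow> 'm::{finite,linorder} \<Rightarrow> real" where
  "grid_point xl xr i = xl + real (grid_index i) * ((xr - xl) / (real CARD('m) - 1))"

definition grid_restrict :: "real \<Rightarrow> real \<Rightarrow> real poly \<Rightarrow> real ^ 'm::{finite,linorder}" where
  "grid_restrict xl xr f = (\<chi> i. poly f (grid_point xl xr i))"

definition e_left :: "real ^ 'm::{finite,linorder}" where
  "e_left = axis (Min UNIV) 1"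

definition e_right :: "real ^ 'm::{finite,linorder}" where
  "e_right = axis (Max UNIV) 1"

definition symmetric_matrix :: "real ^ 'n ^ 'n \<Rightarrow> bool" where
  "symmetric_matrix A \<longleftrightarrow> transpose A = A"

definition psd_matrix :: "real ^ 'n ^ 'n \<Rightarrow> bool" where
  "psd_matrix A \<longleftrightarrow> symmetric_matrix A \<and> (\<forall>x. 0 \<le> x \<bullet> (A *v x))"

definition pd_matrix :: "real ^ 'n ^ 'n \<Rightarrow> bool" where
  "pd_matrix A \<longleftrightarrow> symmetric_matrix A \<and> (\<forall>x. x \<noteq> 0 \<longrightarrow> 0 < x \<bullet> (A *v x))"

definition diagonal_matrix :: "real ^ 'n ^ 'n \<Rightarrow> bool" where
  "diagonal_matrix A \<longleftrightarrow> (\<forall>i j. i \<noteq> j \<longrightarrow> A $ i $ j = 0)"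

definition outer :: "real ^ 'n \<Rightarrow> real ^ 'n \<Rightarrow> real ^ 'n ^ 'n" where
  "outer x y = (columnvector x :: real ^ 1 ^ 'n) ** (rowvector y :: real ^ 'n ^ 1)"

text \<open>
  Outside \<open>r\<close> rows at each end, a narrow stencil approximating the fourth derivative to order
  \<open>2 p\<close> has \<open>2 p + 3\<close> points (half-width \<open>p + 1\<close>) and is exact for polynomials of degree
  less than \<open>2 p + 4\<close>. No accuracy is required of the boundary rows.
\<close>

definition narrow_interior_stencil ::
    "real \<Rightarrow> real \<Rightarrow> nat \<Rightarrow> real ^ 'm::{finite,linorder} ^ 'm::{finite,linorder} \<Rightarrow> bool" where
  "narrow_interior_stencil xl xr p D \<longleftrightarrow>
     (\<exists>r. p + 1 \<le> r \<and> 2 * r < CARD('m) \<and>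
        (\<forall>i. r \<le> grid_index i \<and> grid_index i + r < CARD('m) \<longrightarrow>
           (\<forall>j. \<bar>int (grid_index i) - int (grid_index j)\<bar> > int p + 1 \<longrightarrow> D $ i $ j = 0) \<and>
           (\<forall>f. degree f \<le> 2 * p + 3 \<longrightarrow>
              (D *v grid_restrict xl xr f) $ i = poly ((pderiv ^^ 4) f) (grid_point xl xr i))))"

text \<open>
  Consistency of a difference formula at the boundary point \<open>x\<close> for \<open>s\<close> times the derivative
  of order \<open>k\<close>: exactness for polynomials of degree at most \<open>k\<close>, i.e. at least first order.
\<close>

definition approximates_deriv ::
    "real \<Rightarrow> real \<Rightarrow> nat \<Rightarrow> real \<Rightarrow> real \<Rightarrow> real ^ 'm::{finite,linorder} \<Rightarrow> bool" where
  "approximates_deriv xl xr k s x d \<longleftrightarrow>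
     (\<forall>f. degree f \<le> k \<longrightarrow> d \<bullet> grid_restrict xl xr f = s * poly ((pderiv ^^ k) f) x)"

definition diagonal_norm_SBP4 ::
    "real \<Rightarrow> real \<Rightarrow> nat \<Rightarrow>
     real ^ 'm::{finite,linorder} ^ 'm::{finite,linorder} \<Rightarrow>
     real ^ 'm::{finite,linorder} ^ 'm::{finite,linorder} \<Rightarrow>
     real ^ 'm::{finite,linorder} ^ 'm::{finite,linorder} \<Rightarrow>
     real ^ 'm::{finite,linorder} \<Rightarrow> real ^ 'm::{finite,linorder} \<Rightarrow>
     real ^ 'm::{finite,linorder} \<Rightarrow> real ^ 'm::{finite,linorder} \<Rightarrow>
     real ^ 'm::{finite,linorder} \<Rightarrow> real ^ 'm::{finite,linorder} \<Rightarrow> bool"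
  where
  "diagonal_norm_SBP4 xl xr p D4 H N d1l d1r d2l d2r d3l d3r \<longleftrightarrow>
     diagonal_matrix H \<and> pd_matrix H \<and> psd_matrix N \<and>
     D4 = matrix_inv H **
       (N + outer e_left d3l + outer d1l d2l + outer e_right d3r - outer d1r d2r) \<and>
     narrow_interior_stencil xl xr p D4 \<and>
     approximates_deriv xl xr 1 (- 1) xl d1l \<and> approximates_deriv xl xr 1 1 xr d1r \<and>
     approximates_deriv xl xr 2 (- 1) xl d2l \<and> approximates_deriv xl xr 2 1 xr d2r \<and>
     approximates_deriv xl xr 3 (- 1) xl d3l \<and> approximates_deriv xl xr 3 1 xr d3r"

definition clamped_bc :: "real ^ 'm::{finite,linorder} \<Rightarrow> real ^ 'm::{finite,linorder} \<Rightarrow> real ^ 'm::{finite,linorder} ^ 4"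
  where "clamped_bc d1l d1r = vector [e_left, d1l, e_right, d1r]"

definition linearly_independent_rows :: "real ^ 'n ^ 'k \<Rightarrow> bool" where
  "linearly_independent_rows A \<longleftrightarrow> inj (\<lambda>i. row i A) \<and> independent (rows A)"

definition bc_projection :: "real ^ 'm ^ 'm \<Rightarrow> real ^ 'm ^ 'k \<Rightarrow> real ^ 'm ^ 'm" where
  "bc_projection H L =
     mat 1 - matrix_inv H ** transpose L ** matrix_inv (L ** matrix_inv H ** transpose L) ** L"

definition norm_sq :: "real ^ 'm ^ 'm \<Rightarrow> real ^ 'm \<Rightarrow> real" where
  "norm_sq H v = v \<bullet> (H *v v)"

text \<open>
  A twice continuously differentiable solution on the time interval \<open>t \<ge> 0\<close> of the second-order
  system \<open>b v'' = A v\<close>, given together with its derivatives.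
\<close>

definition C2_solution ::
    "real \<Rightarrow> real ^ 'm ^ 'm \<Rightarrow>
     (real \<Rightarrow> real ^ 'm) \<Rightarrow> (real \<Rightarrow> real ^ 'm) \<Rightarrow> (real \<Rightarrow> real ^ 'm) \<Rightarrow> bool" where
  "C2_solution b A v v' v'' \<longleftrightarrow>
     (\<forall>t\<ge>0. (v has_vector_derivative v' t) (at t within {0..})) \<and>
     (\<forall>t\<ge>0. (v' has_vector_derivative v'' t) (at t within {0..})) \<and>
     continuous_on {0..} v'' \<and>
     (\<forall>t\<ge>0. b *\<^sub>R v'' t = A *v v t)"

definition energy_stable :: "real \<Rightarrow> real ^ 'm ^ 'm \<Rightarrow> real ^ 'm ^ 'm \<Rightarrow> bool" where
  "energy_stable b H A \<longleftrightarrow>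
     (\<exists>M. psd_matrix M \<and>
        (\<forall>v v' v''. C2_solution b A v v' v'' \<longrightarrow>
           (\<forall>t\<ge>0. \<exists>dE.
              ((\<lambda>s. b * norm_sq H (v' s) + v s \<bullet> (M *v v s)) has_real_derivative dE)
                (at t within {0..}) \<and> dE \<le> 0)))"

end

theory Submission
  imports Defs
begin

text \<open>
  \<open>P\<close> is the \<open>H\<close>-orthogonal projection onto the kernel of \<open>L\<close>, so \<open>x\<^sup>T H P y = (P x)\<^sup>T H y\<close>. As
  \<open>L P = 0\<close>, every boundary term of \<open>H D\<^sub>4\<close> has a factor \<open>e\<^sub>l\<close>, \<open>d\<^sub>1\<^sub>l\<close>, \<open>e\<^sub>r\<close> or \<open>d\<^sub>1\<^sub>r\<close> that is
  orthogonal to the range of \<open>P\<close>; only \<open>N\<close> survives and \<open>H P D\<^sub>4 P = P\<^sup>T N P\<close>. With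
  \<open>M = a P\<^sup>T N P\<close> the energy is therefore conserved.
\<close>

lemma inner_transpose_mult:
  fixes A :: "real ^ 'n ^ 'k"
  shows "x \<bullet> (transpose A *v y) = (A *v x) \<bullet> y"
  by (metis dot_lmul_matrix inner_commute transpose_matrix_vector)

lemma symmetric_matrix_inner:
  assumes "symmetric_matrix A"
  shows "x \<bullet> (A *v y) = (A *v x) \<bullet> y"
  using assms inner_transpose_mult[of x A y] by (simp add: symmetric_matrix_def)

lemma matrix_inv_works:
  assumes "invertible A"
  shows "A ** matrix_inv A = mat 1" "matrix_inv A ** A = mat 1"
  using someI_ex[OF assms[unfolded invertible_def]] by (simp_all add: matrix_inv_def)

lemma invertible_if_kernel_trivial:
  fixes A :: "real ^ 'n ^ 'n"
  assumes "\<And>x. A *v x = 0 \<Longrightarrow> x = 0"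
  shows "invertible A"
  using assms by (simp add: invertible_left_inverse matrix_left_invertible_ker)

lemma pd_matrix_invertible:
  assumes "pd_matrix A"
  shows "invertible A"
  by (rule invertible_if_kernel_trivial)
    (use assms in \<open>force simp: pd_matrix_def\<close>)

text \<open>Substituting \<open>x = A *v y\<close> turns the quadratic form of the inverse at
  \<open>x\<close> into the form of \<open>A\<close> at \<open>y\<close>, and \<open>y\<close> is
  nonzero because \<open>x\<close> is.\<close>

lemma pd_matrix_inv_inner_pos:
  fixes A :: "real ^ 'n ^ 'n"
  assumes "pd_matrix A" "x \<noteq> 0"
  shows "0 < x \<bullet> (matrix_inv A *v x)"
proof -
  define y where "y = matrix_inv A *v x"
  have x: "x = A *v y"
    by (simp add: y_def matrix_vector_mul_assoc matrix_inv_works pd_matrix_invertible assms)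
  then have "y \<noteq> 0" using assms(2) by auto
  then have "0 < y \<bullet> (A *v y)" using assms(1) by (simp add: pd_matrix_def)
  then show ?thesis
    by (metis inner_commute x y_def)
qed

text \<open>\<open>transpose L *v x\<close> is the linear combination of the rows of
  \<open>L\<close> with coefficients \<open>x $ i\<close>. Independence concerns the set of rows,
  where equal rows collapse, so injectivity of the row map is what separates the individual
  coefficients.\<close>

lemma transpose_mult_eq_0_iff:
  fixes L :: "real ^ 'n ^ 'k"
  assumes "linearly_independent_rows L"
  shows "transpose L *v x = 0 \<longleftrightarrow> x = 0"
proof
  assume "transpose L *v x = 0"
  then have "(\<Sum>i\<in>UNIV. x $ i *\<^sub>R row i L) = 0"
    by (simp add: matrix_mult_sum[of "transpose L"] scalar_mult_eq_scaleR del: transpose_matrix_vector)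
  moreover have inj: "inj (\<lambda>i. row i L)" and ind: "independent (range (\<lambda>i. row i L))"
    using assms by (simp_all add: linearly_independent_rows_def rows_def full_SetCompr_eq)
  \<comment> \<open>\<open>independentD\<close> takes coefficients indexed by the vectors
    themselves; \<open>u\<close> transports the components of \<open>x\<close> along the inverse of
    the row map.\<close>
  define u where "u v = x $ inv (\<lambda>i. row i L) v" for v
  have u: "u (row i L) = x $ i" for i
    using inj by (simp add: u_def inv_f_f[where f = "\<lambda>i. row i L"])
  ultimately have "(\<Sum>v\<in>range (\<lambda>i. row i L). u v *\<^sub>R v) = 0"
    by (simp add: sum.reindex[OF inj] o_def)
  then have "u (row i L) = 0" for i
    by (intro independentD[OF ind]) auto
  then show "x = 0" by (simp add: u vec_eq_iff)
qed simp

context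
  fixes H :: "real ^ 'n ^ 'n" and L :: "real ^ 'n ^ 'k"
  assumes H: "pd_matrix H" and L: "linearly_independent_rows L"
begin

text \<open>Pairing a kernel vector \<open>x\<close> with its zero image gives the form of
  \<open>matrix_inv H\<close> at \<open>transpose L *v x\<close>. Positivity forces this vector to
  vanish, and independence of the rows then gives \<open>x = 0\<close>.\<close>

lemma invertible_schur:
  "invertible (L ** matrix_inv H ** transpose L)"
proof (rule invertible_if_kernel_trivial)
  fix x assume "(L ** matrix_inv H ** transpose L) *v x = 0"
  then have "0 = x \<bullet> (L *v (matrix_inv H *v (transpose L *v x)))"
    by (simp del: transpose_matrix_vector flip: matrix_vector_mul_assoc)
  also have "\<dots> = (transpose L *v x) \<bullet> (matrix_inv H *v (transpose L *v x))"
    by (simp add: dot_lmul_matrix)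
  finally show "x = 0"
    using pd_matrix_inv_inner_pos[OF H, of "transpose L *v x"] transpose_mult_eq_0_iff[OF L, of x]
    by linarith
qed

lemma bc_projection_mult:
  "bc_projection H L *v x =
     x - matrix_inv H *v (transpose L *v (matrix_inv (L ** matrix_inv H ** transpose L) *v (L *v x)))"
  by (simp add: bc_projection_def matrix_vector_mult_diff_rdistrib del: transpose_matrix_vector
      flip: matrix_vector_mul_assoc)

lemma mult_bc_projection_eq_0: "L *v (bc_projection H L *v x) = 0"
proof -
  let ?G = "L ** matrix_inv H ** transpose L"
  have "L *v (bc_projection H L *v x) = L *v x - (?G ** matrix_inv ?G) *v (L *v x)"
    by (simp add: bc_projection_mult matrix_vector_mult_diff_distrib del: transpose_matrix_vector
        flip: matrix_vector_mul_assoc)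
  then show ?thesis by (simp add: matrix_inv_works invertible_schur)
qed

text \<open>After multiplication by \<open>H\<close>, the correction subtracted by the projection
  lies in the range of \<open>transpose L\<close>, which is orthogonal to the kernel of
  \<open>L\<close>.\<close>

lemma inner_bc_projection_of_kernel:
  assumes "L *v w = 0"
  shows "w \<bullet> (H *v (bc_projection H L *v x)) = w \<bullet> (H *v x)"
proof -
  define y where "y = matrix_inv (L ** matrix_inv H ** transpose L) *v (L *v x)"
  have "H *v (bc_projection H L *v x) = H *v x - (H ** matrix_inv H) *v (transpose L *v y)"
    by (simp add: bc_projection_mult y_def matrix_vector_mult_diff_distrib
        del: transpose_matrix_vector flip: matrix_vector_mul_assoc)
  then have "H *v (bc_projection H L *v x) = H *v x - transpose L *v y"
    by (simp add: matrix_inv_works pd_matrix_invertible H del: transpose_matrix_vector)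
  then show ?thesis
    by (simp add: inner_diff_right inner_transpose_mult assms del: transpose_matrix_vector)
qed

text \<open>Both sides equal the \<open>H\<close>-inner product of the two projected vectors.
  Projections lie in the kernel of \<open>L\<close>, so against one of them the projection of the
  other argument may be inserted or removed; symmetry of \<open>H\<close> exchanges the
  roles.\<close>

lemma bc_projection_self_adjoint:
  "x \<bullet> (H *v (bc_projection H L *v y)) = (bc_projection H L *v x) \<bullet> (H *v y)"
proof -
  let ?P = "bc_projection H L"
  have sym: "symmetric_matrix H" using H by (simp add: pd_matrix_def)
  have "x \<bullet> (H *v (?P *v y)) = (?P *v y) \<bullet> (H *v x)"
    by (subst symmetric_matrix_inner[OF sym]) (rule inner_commute)
  also have "\<dots> = (?P *v y) \<bullet> (H *v (?P *v x))"
    by (simp add: inner_bc_projection_of_kernel mult_bc_projection_eq_0)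
  also have "\<dots> = (?P *v x) \<bullet> (H *v (?P *v y))"
    by (subst symmetric_matrix_inner[OF sym]) (rule inner_commute)
  also have "\<dots> = (?P *v x) \<bullet> (H *v y)"
    by (simp add: inner_bc_projection_of_kernel mult_bc_projection_eq_0)
  finally show ?thesis .
qed

end

lemma outer_mult: "outer x y *v z = (y \<bullet> z) *\<^sub>R x"
  by (simp add: outer_def vec_eq_iff matrix_vector_mult_def matrix_matrix_mult_def columnvector_def
      rowvector_def inner_vec_def sum_distrib_left mult_ac)

lemma vector_4 [simp]:
  fixes w x y z :: "'a::zero"
  shows "(vector [w, x, y, z] :: 'a ^ 4) $ 1 = w" "(vector [w, x, y, z] :: 'a ^ 4) $ 2 = x"
    "(vector [w, x, y, z] :: 'a ^ 4) $ 3 = y" "(vector [w, x, y, z] :: 'a ^ 4) $ 4 = z"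
  by (simp_all add: vector_def)

lemma clamped_bc_mult_eq_0_iff:
  "clamped_bc d1l d1r *v w = 0 \<longleftrightarrow>
     w \<bullet> e_left = 0 \<and> w \<bullet> d1l = 0 \<and> w \<bullet> e_right = 0 \<and> w \<bullet> d1r = 0"
  by (simp add: vec_eq_iff[of _ 0] forall_4 matrix_vector_mul_component clamped_bc_def inner_commute)

text \<open>Multiplication by \<open>H\<close> cancels \<open>matrix_inv H\<close> in
  \<open>D4\<close>. Each \<open>outer\<close> term then sends \<open>z\<close> to a multiple of its
  first factor, a row of the clamped conditions and hence orthogonal to \<open>w\<close>. Nothing is
  asked of \<open>z\<close>.\<close>

lemma SBP4_inner_clamped:
  assumes "diagonal_norm_SBP4 xl xr p D4 H N d1l d1r d2l d2r d3l d3r"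
    and w: "clamped_bc d1l d1r *v w = 0"
  shows "w \<bullet> (H *v (D4 *v z)) = w \<bullet> (N *v z)"
proof -
  define B where "B = N + outer e_left d3l + outer d1l d2l + outer e_right d3r - outer d1r d2r"
  have "pd_matrix H" "D4 = matrix_inv H ** B"
    using assms(1) by (simp_all add: diagonal_norm_SBP4_def B_def)
  then have "H *v (D4 *v z) = B *v z"
    by (simp add: matrix_vector_mul_assoc matrix_mul_assoc matrix_inv_works pd_matrix_invertible)
  also have "w \<bullet> (B *v z) = w \<bullet> (N *v z)"
    using w unfolding clamped_bc_mult_eq_0_iff
    by (simp add: B_def matrix_vector_mult_add_rdistrib matrix_vector_mult_diff_rdistrib
        outer_mult inner_add_right inner_diff_right)
  finally show ?thesis .
qed

lemma psd_matrix_congruence: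
  fixes N :: "real ^ 'n ^ 'n" and A :: "real ^ 'k ^ 'n"
  assumes "psd_matrix N" "0 \<le> c"
  shows "psd_matrix (c *\<^sub>R (transpose A ** N ** A))"
  using assms
  by (simp add: psd_matrix_def symmetric_matrix_def transpose_scalar matrix_transpose_mul
      matrix_mul_assoc scaleR_matrix_vector_assoc[symmetric] matrix_vector_mul_assoc[symmetric]
      inner_transpose_mult del: transpose_matrix_vector)

text \<open>The product rule gives two terms, which symmetry of \<open>A\<close> makes
  equal.\<close>

lemma quadratic_form_has_derivative:
  fixes A :: "real ^ 'n ^ 'n"
  assumes "symmetric_matrix A" "(v has_vector_derivative v') (at t within S)"
  shows "((\<lambda>s. v s \<bullet> (A *v v s)) has_real_derivative 2 * (v t \<bullet> (A *v v'))) (at t within S)"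
proof -
  have v: "(v has_derivative (\<lambda>h. h *\<^sub>R v')) (at t within S)"
    using assms(2) by (simp add: has_vector_derivative_def)
  have "((\<lambda>s. A *v v s) has_derivative (\<lambda>h. A *v (h *\<^sub>R v'))) (at t within S)"
    by (rule bounded_linear.has_derivative[OF matrix_vector_mul_bounded_linear v])
  from has_derivative_inner[OF v this] show ?thesis
    by (rule has_derivative_imp_has_field_derivative)
      (use symmetric_matrix_inner[OF assms(1), of "v t" v'] in
        \<open>simp add: matrix_vector_mult_scaleR inner_commute\<close>)
qed

text \<open>The assumption \<open>eq\<close> is the identity \<open>H ** A = - M\<close>, tested
  against vectors. It makes the kinetic and potential contributions to the energy rate cancel, so
  the energy is conserved.\<close>

lemma energy_stableI:
  assumes H: "symmetric_matrix H" and M: "psd_matrix M"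
    and eq: "\<And>x y. x \<bullet> (H *v (A *v y)) = - (x \<bullet> (M *v y))"
  shows "energy_stable b H A"
  unfolding energy_stable_def
proof (intro exI[of _ M] conjI allI impI M)
  fix v v' v'' :: "real \<Rightarrow> real ^ 'a" and t :: real
  assume "C2_solution b A v v' v''" and t: "0 \<le> t"
  then have v: "(v has_vector_derivative v' t) (at t within {0..})"
    and v': "(v' has_vector_derivative v'' t) (at t within {0..})"
    and ode: "b *\<^sub>R v'' t = A *v v t"
    by (simp_all add: C2_solution_def)
  have symM: "symmetric_matrix M" using M by (simp add: psd_matrix_def)
  let ?dE = "b * (2 * (v' t \<bullet> (H *v v'' t))) + 2 * (v t \<bullet> (M *v v' t))"
  have "((\<lambda>s. b * norm_sq H (v' s) + v s \<bullet> (M *v v s)) has_real_derivative ?dE) (at t within {0..})"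
    unfolding norm_sq_def
    by (intro DERIV_add DERIV_cmult quadratic_form_has_derivative H symM v v')
  \<comment> \<open>The differential equation replaces \<open>b *\<^sub>R v'' t\<close> as a whole;
    \<open>eq\<close> then turns the kinetic term into minus the potential one.\<close>
  moreover have "b * (v' t \<bullet> (H *v v'' t)) = v' t \<bullet> (H *v (A *v v t))"
    by (simp add: ode[symmetric] matrix_vector_mult_scaleR)
  then have "?dE = 0"
    using symmetric_matrix_inner[OF symM, of "v t" "v' t"] eq[of "v' t" "v t"]
    by (simp add: inner_commute)
  ultimately show "\<exists>dE. ((\<lambda>s. b * norm_sq H (v' s) + v s \<bullet> (M *v v s)) has_real_derivative dE)
      (at t within {0..}) \<and> dE \<le> 0"
    by (metis order_refl)
qed

theorem lemma2:
  fixes a b xl xr :: real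
    and p :: nat
    and D4 H N :: "real ^ 'm::{finite,linorder} ^ 'm::{finite,linorder}"
    and d1l d1r d2l d2r d3l d3r :: "real ^ 'm::{finite,linorder}"
  defines "L \<equiv> clamped_bc d1l d1r"
  defines "P \<equiv> bc_projection H L"
  assumes "a > 0" "b > 0" "xl < xr" "p \<ge> 1"
    and "diagonal_norm_SBP4 xl xr p D4 H N d1l d1r d2l d2r d3l d3r"
    and "linearly_independent_rows L"
  shows "energy_stable b H (- (a *\<^sub>R (P ** D4 ** P)))"
proof (rule energy_stableI)
  have H: "pd_matrix H" and N: "psd_matrix N"
    using assms(7) by (simp_all add: diagonal_norm_SBP4_def)
  show "symmetric_matrix H" using H by (simp add: pd_matrix_def)
  show "psd_matrix (a *\<^sub>R (transpose P ** N ** P))"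
    using N \<open>a > 0\<close> by (simp add: psd_matrix_congruence)
  fix x y
  \<comment> \<open>Moving the left \<open>P\<close> onto the test vector \<open>x\<close> puts that
    vector into the kernel of \<open>L\<close>, where the boundary terms of \<open>D4\<close> drop
    out. The right \<open>P\<close> is simply carried along and makes the remaining matrix
    symmetric.\<close>
  have "x \<bullet> (H *v (P *v (D4 *v (P *v y)))) = (P *v x) \<bullet> (H *v (D4 *v (P *v y)))"
    unfolding P_def by (rule bc_projection_self_adjoint[OF H assms(8)])
  also have "\<dots> = (P *v x) \<bullet> (N *v (P *v y))"
    using mult_bc_projection_eq_0[OF H assms(8), of x]
    by (intro SBP4_inner_clamped[OF assms(7)]) (simp add: P_def L_def)
  also have "\<dots> = x \<bullet> ((transpose P ** N ** P) *v y)"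
    by (simp add: matrix_vector_mul_assoc[symmetric] inner_transpose_mult
        del: transpose_matrix_vector)
  finally have key: "x \<bullet> (H *v (P *v (D4 *v (P *v y)))) = x \<bullet> ((transpose P ** N ** P) *v y)" .
  have "- (a *\<^sub>R (P ** D4 ** P)) *v y = (- a) *\<^sub>R (P *v (D4 *v (P *v y)))"
    by (simp add: scaleR_matrix_vector_assoc matrix_vector_mul_assoc matrix_mul_assoc
        flip: scaleR_minus_left)
  then show "x \<bullet> (H *v (- (a *\<^sub>R (P ** D4 ** P)) *v y)) =
      - (x \<bullet> ((a *\<^sub>R (transpose P ** N ** P)) *v y))"
    by (simp only: matrix_vector_mult_scaleR scaleR_matrix_vector_assoc[symmetric]
        inner_scaleR_right key mult_minus_left)
qed

end
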